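(* Let $q$ be a prime power, $n\ge2$, and let $f(x),g(x)$ be $q$-polynomials in $\mathcal{L}_{n,q}$ admitting $\mathbb{F}_q$ as maximum field of linearity. Then $\mathcal{B}_f$ and $\mathcal{B}_g$ are $\mathrm{P\Gamma L}(3,q^n)$-equivalent if and only if $f(x)$ and $g(x)$ are equivalent. Also, $\mathcal{B}_f$ and $\mathcal{B}_g$ are $\mathrm{PGL}(3,q^n)$-equivalent if and only if $f(x)$ and $g(x)$ are linearly equivalent.
   Context: $\mathcal{L}_{n,q}=\{\sum_{i=0}^{n-1}a_ix^{q^i}:a_i\in\mathbb{F}_{q^n}\}$ is the set of $q$-polynomials. For $f\in\mathcal{L}_{n,q}$, $\mathcal{B}_f=\{\langle (x,f(x),\alpha)\rangle_{\mathbb{F}_{q^n}} : x\in\mathbb{F}_{q^n},\alpha\in\mathbb{F}_q,(x,\alpha)\neq(0,0)\}\subseteq\mathrm{PG}(2,q^n)$ (equivalently, the union of $\{\langle (x,f(x),1)\rangle: x\in\mathbb{F}_{q^n}\}$ and $\{\langle (x,f(x),0)\rangle: x\in\mathbb{F}_{q^n}^*\}$). $f$ has maximum field of linearity $\mathbb{F}_q$ if there is no divisor $d>1$ of $n$ with $f(\lambda x)=\lambda f(x)$ for all $\lambda\in\mathbb{F}_{q^d}$, $x\in\mathbb{F}_{q^n}$. Two $q$-polynomials $f,g$ are equivalent if there is $\varphi\in\Gamma\mathrm{L}(2,q^n)$ with $\varphi(U_f)=U_g$, where $U_f=\{(x,f(x)):x\in\mathbb{F}_{q^n}\}\subseteq\mathbb{F}_{q^n}^2$;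 they are linearly equivalent if such $\varphi$ exists in $\mathrm{GL}(2,q^n)$. Two pointsets are $\mathrm{P\Gamma L}(3,q^n)$- (resp. $\mathrm{PGL}(3,q^n)$-) equivalent if some element of that group maps one onto the other. *)

theory Defs
  imports "HOL-Analysis.Analysis" "HOL-Computational_Algebra.Polynomial"
    "HOL-Number_Theory.Prime_Powers"
begin

text \<open>
  The field of order \<open>q\<^sup>n\<close> is a finite field type \<open>'a\<close> with \<open>CARD('a) = q ^ n\<close>. For \<open>d dvd n\<close>, its unique
  subfield of order \<open>m = q\<^sup>d\<close> is the set of roots of \<open>X\<^sup>m - X\<close>.
\<close>

definition subfield_of_order :: "nat \<Rightarrow> 'a::{field,finite} set" where
  "subfield_of_order m = {x. x ^ m = x}"

definition q_polynomials :: "nat \<Rightarrow> nat \<Rightarrow> 'a::{field,finite} poly set" where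
  "q_polynomials n q = {\<Sum>i<n. monom (a i) (q ^ i) | a. True}"

definition max_field_of_linearity_is_base :: "nat \<Rightarrow> nat \<Rightarrow> 'a::{field,finite} poly \<Rightarrow> bool" where
  "max_field_of_linearity_is_base n q f \<longleftrightarrow>
     \<not> (\<exists>d. d dvd n \<and> d > 1 \<and>
          (\<forall>l\<in>subfield_of_order (q ^ d). \<forall>x. poly f (l * x) = l * poly f x))"

definition field_automorphism :: "('a::field \<Rightarrow> 'a) \<Rightarrow> bool" where
  "field_automorphism \<sigma> \<longleftrightarrow>
     bij \<sigma> \<and> (\<forall>x y. \<sigma> (x + y) = \<sigma> x + \<sigma> y) \<and> (\<forall>x y. \<sigma> (x * y) = \<sigma> x * \<sigma> y)"

definition GL :: "('a::field ^ 'm \<Rightarrow> 'a ^ 'm) set" where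
  "GL = {\<phi>. bij \<phi> \<and> Vector_Spaces.linear (*s) (*s) \<phi>}"

definition GammaL :: "('a::field ^ 'm \<Rightarrow> 'a ^ 'm) set" where
  "GammaL = {\<phi>. bij \<phi> \<and> (\<forall>v w. \<phi> (v + w) = \<phi> v + \<phi> w) \<and>
                 (\<exists>\<sigma>. field_automorphism \<sigma> \<and> (\<forall>c v. \<phi> (c *s v) = \<sigma> c *s \<phi> v))}"

definition proj_points :: "('a::field ^ 'm) set set" where
  "proj_points = {vec.span {v} | v. v \<noteq> 0}"

text \<open>
  The projective groups consist of the induced maps on points. Restricting to points identifies
  exactly those maps that differ by a nonzero scalar.
\<close>

definition PGL :: "(('a::field ^ 'm) set \<Rightarrow> ('a ^ 'm) set) set" where
  "PGL = {restrict (image \<phi>) proj_points | \<phi>. \<phi> \<in> GL}"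

definition PGammaL :: "(('a::field ^ 'm) set \<Rightarrow> ('a ^ 'm) set) set" where
  "PGammaL = {restrict (image \<phi>) proj_points | \<phi>. \<phi> \<in> GammaL}"

definition equivalent_under :: "('b \<Rightarrow> 'b) set \<Rightarrow> 'b set \<Rightarrow> 'b set \<Rightarrow> bool" where
  "equivalent_under G X Y \<longleftrightarrow> (\<exists>\<phi>\<in>G. \<phi> ` X = Y)"

definition U_set :: "'a::{field,finite} poly \<Rightarrow> ('a ^ 2) set" where
  "U_set f = {vector [x, poly f x] | x. True}"

definition B_set :: "nat \<Rightarrow> 'a::{field,finite} poly \<Rightarrow> ('a ^ 3) set set" where
  "B_set q f = {vec.span {vector [x, poly f x, \<alpha>]} | x \<alpha>.
                  \<alpha> \<in> subfield_of_order q \<and> (x, \<alpha>) \<noteq> (0, 0)}"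

definition q_poly_equivalent :: "'a::{field,finite} poly \<Rightarrow> 'a poly \<Rightarrow> bool" where
  "q_poly_equivalent f g \<longleftrightarrow> equivalent_under GammaL (U_set f) (U_set g)"

definition q_poly_linearly_equivalent :: "'a::{field,finite} poly \<Rightarrow> 'a poly \<Rightarrow> bool" where
  "q_poly_linearly_equivalent f g \<longleftrightarrow> equivalent_under GL (U_set f) (U_set g)"

end

theory Submission imports Defs begin

text \<open>
  If the projectivity \<open>\<psi>\<close> preserves the line \<open>z = 0\<close>, it acts on the affine points as a semilinear map
  followed by a translation; the translation vector lies in the additive group \<open>U_set g\<close>, so the
  semilinear part already maps \<open>U_set f\<close> onto \<open>U_set g\<close>. Otherwise \<open>B_set q f\<close> and \<open>B_set q g\<close> both
  have a second line whose complement contains exactly \<open>q\<^sup>n\<close> of their points. Write \<open>p\<close> for the slope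
  of that line, \<open>h x = f x - p x\<close>, \<open>A = ker h\<close>. Counting shows that \<open>h\<close> has \<open>|A|\<close> nonzero slopes
  \<open>h x / x\<close>, that each slope space \<open>{x. h x = m x}\<close> is a complement of \<open>A\<close>, and hence that
  \<open>{y / m | m slope}\<close> is the fibre of \<open>h\<close> over \<open>y\<close> for every nonzero \<open>y\<close> in the image. This makes \<open>h\<close>
  linear over the field \<open>{l. l A \<subseteq> A}\<close>, a multiple of the image of \<open>h\<close>. By maximality this field is
  \<open>GF(q)\<close>, so \<open>f x = p x + y Tr(d x)\<close>. The same holds for \<open>g\<close>, and any two such polynomials are
  linearly equivalent.
\<close>

subsection \<open>Additive maps with few slopes\<close>

text \<open>Every estimate in the count is tight. Since \<open>card M = card A\<close>, the sizes of
  the slope spaces \<open>V m\<close> add up to the field order, while directness of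
  \<open>V m + A\<close> bounds each of them by that order divided by \<open>card A\<close>. The
  quotients \<open>h x / y0\<close> then form the field over which \<open>h\<close> is
  linear.\<close>

lemma additive_with_few_slopes:
  fixes h :: "'a::{field,finite} \<Rightarrow> 'a"
  assumes add: "\<And>x y. h (x + y) = h x + h y"
    and card_slopes: "card {m. m \<noteq> 0 \<and> (\<exists>x. x \<noteq> 0 \<and> h x = m * x)} = card {x. h x = 0}"
  shows "\<exists>y0. y0 \<noteq> 0 \<and> (\<forall>x u. h (h x / y0 * u) = h x / y0 * h u)"
proof -
  define M where "M = {m. m \<noteq> 0 \<and> (\<exists>x. x \<noteq> 0 \<and> h x = m * x)}"
  define V where "V m = {x. h x = m * x}" for m
  define A where "A = {x. h x = 0}"
  have h0: "h 0 = 0" using add[of 0 0] by (metis add_0 add_cancel_right_right)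
  have sub: "h (x - y) = h x - h y" for x y
    using add[of "x - y" y] by (simp add: algebra_simps)
  have card_M: "card M = card A" using card_slopes by (simp add: M_def A_def)
  have A0: "0 \<in> A" by (simp add: A_def h0)
  have V0: "0 \<in> V m" for m by (simp add: V_def h0)

  have V_pos: "card (V m) \<ge> 1" for m
    using V0[of m] by (metis One_nat_def Suc_leI card_gt_0_iff empty_iff finite)
  have "UNIV = A \<union> (\<Union>m\<in>M. V m - {0})"
  proof -
    have "x \<in> A \<union> (\<Union>m\<in>M. V m - {0})" for x
    proof (cases "h x = 0")
      case False
      then have "x \<noteq> 0" using h0 by auto
      with False have "h x / x \<in> M" "x \<in> V (h x / x) - {0}" by (auto simp: M_def V_def)
      then show ?thesis by blast
    qed (simp add: A_def)
    then show ?thesis by blast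
  qed
  moreover have "A \<inter> (\<Union>m\<in>M. V m - {0}) = {}" by (auto simp: A_def M_def V_def)
  ultimately have "CARD('a) = card A + card (\<Union>m\<in>M. V m - {0})"
    by (metis card_Un_disjoint finite)
  also have "card (\<Union>m\<in>M. V m - {0}) = (\<Sum>m\<in>M. card (V m - {0}))"
    by (rule card_UN_disjoint) (auto simp: V_def)
  also have "\<dots> = (\<Sum>m\<in>M. card (V m) - 1)" using V0 by simp
  \<comment> \<open>There are \<open>card A\<close> slopes, so \<open>card A\<close> supplies one
    unit per slope. It restores the zero vector removed from each \<open>V m\<close>.\<close>
  also have "card A + \<dots> = (\<Sum>m\<in>M. 1 + (card (V m) - 1))"
    by (simp only: sum.distrib) (simp add: card_M)
  also have "\<dots> = (\<Sum>m\<in>M. card (V m))"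
    using V_pos by (intro sum.cong refl le_add_diff_inverse)
  finally have sum_V: "(\<Sum>m\<in>M. card (V m)) = CARD('a)" by simp

  have inj: "inj_on (\<lambda>(v, a). v + a) (V m \<times> A)" if "m \<in> M" for m
  proof (rule inj_onI, clarsimp)
    fix v a v' a' assume *: "v \<in> V m" "a \<in> A" "v' \<in> V m" "a' \<in> A" "v + a = v' + a'"
    have "h v + h a = h v' + h a'" using * add by metis
    with * have "m * v = m * v'" by (simp add: V_def A_def)
    with \<open>m \<in> M\<close> * show "v = v' \<and> a = a'" by (auto simp: M_def)
  qed
  have le: "card (V m) * card A \<le> CARD('a)" if "m \<in> M" for m
    using card_mono[OF finite subset_UNIV, of "(\<lambda>(v, a). v + a) ` (V m \<times> A)"] inj[OF that]
    by (simp add: card_image card_cartesian_product)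
  have "(\<Sum>m\<in>M. card (V m) * card A) = (\<Sum>m\<in>M. CARD('a))"
    using sum_V by (simp add: card_M flip: sum_distrib_right)
  then have eq: "card (V m) * card A = CARD('a)" if "m \<in> M" for m
    by (rule sum_mono_inv) (use le that in auto)
  have onto: "(\<lambda>(v, a). v + a) ` (V m \<times> A) = UNIV" if "m \<in> M" for m
    by (rule card_subset_eq)
      (use eq[OF that] inj[OF that] in \<open>auto simp: card_image card_cartesian_product\<close>)
  \<comment> \<open>Split \<open>x\<close> along \<open>V m\<close> and \<open>A\<close>: the part
    in \<open>V m\<close> has the same image \<open>h x\<close>, hence equals
    \<open>h x / m\<close>.\<close>
  have section_inv: "h (h x * inverse m) = h x" if "m \<in> M" for x m
  proof -
    have "x \<in> (\<lambda>(v, a). v + a) ` (V m \<times> A)" using onto[OF that] by simp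
    then obtain v a where "v \<in> V m" "a \<in> A" "x = v + a" by auto
    then have "h v = h x" "h v = m * v" by (simp_all add: add V_def A_def)
    moreover have "m \<noteq> 0" using that by (simp add: M_def)
    ultimately have "h x * inverse m = v" by (simp add: field_simps)
    with \<open>h v = h x\<close> show ?thesis by simp
  qed

  \<comment> \<open>For nonzero \<open>y\<close> in the image of \<open>h\<close>, the elements
    \<open>y * e\<close> with \<open>e\<close> in \<open>E\<close> are preimages of
    \<open>y\<close>. They are as many as the kernel has elements, so they fill the fibre.\<close>
  define E where "E = inverse ` M"
  have card_E: "card E = card A"
    unfolding E_def card_M[symmetric] by (rule card_image) (auto intro: inj_onI)
  have hE: "h (y * e) = y" if "e \<in> E" "y \<in> range h" for y e
    using that section_inv by (auto simp: E_def)
  have "card M \<noteq> 0" using card_M A0 by (metis card_0_eq empty_iff finite)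
  then obtain m0 where m0: "m0 \<in> M" by fastforce
  then obtain x0 where "h x0 = m0 * x0" "x0 \<noteq> 0" "m0 \<noteq> 0" by (auto simp: M_def)
  then have "h x0 \<in> range h" "h x0 \<noteq> 0" by (blast, simp)
  then obtain y0 where y0: "y0 \<in> range h" "y0 \<noteq> 0" by blast
  define e0 where "e0 = inverse m0"
  have e0: "e0 \<in> E" using m0 by (simp add: e0_def E_def)
  define w where "w = y0 * e0"
  have hw: "h w = y0" using hE e0 y0 by (simp add: w_def)
  \<comment> \<open>Moving the fibre over \<open>y\<close> to the origin by its point
    \<open>y * e0\<close> gives the same kernel for every \<open>y\<close>.\<close>
  have A_eq: "(\<lambda>e. y * (e - e0)) ` E = A" if "y \<in> range h" "y \<noteq> 0" for y
  proof (rule card_subset_eq)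
    show "(\<lambda>e. y * (e - e0)) ` E \<subseteq> A"
      using hE e0 that by (auto simp: A_def right_diff_distrib sub)
    have "inj_on (\<lambda>e. y * (e - e0)) E" using that by (auto intro: inj_onI)
    then show "card ((\<lambda>e. y * (e - e0)) ` E) = card A" by (simp add: card_image card_E)
  qed simp

  \<comment> \<open>\<open>K\<close> is the multiplier ring of the kernel. Identifying it with
    \<open>J\<close>, the image of \<open>h\<close> scaled to contain 1, makes \<open>J\<close>
    closed under products.\<close>
  define K where "K = {l. \<forall>a\<in>A. l * a \<in> A}"
  define J where "J = (\<lambda>y. y / y0) ` range h"
  have J_K: "J \<subseteq> K"
  proof
    fix l assume "l \<in> J"
    then have ly0: "l * y0 \<in> range h" using y0 by (auto simp: J_def)
    have "l * a \<in> A" if "a \<in> A" for a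
    proof (cases "l = 0")
      case False
      \<comment> \<open>Both \<open>y0\<close> and \<open>l * y0\<close> describe the kernel through
        \<open>A_eq\<close>, and multiplication by \<open>l\<close> carries the first description to
        the second.\<close>
      obtain e where "e \<in> E" "a = y0 * (e - e0)" using A_eq[OF y0] \<open>a \<in> A\<close> by auto
      then have "l * a \<in> (\<lambda>e. (l * y0) * (e - e0)) ` E" by (auto simp: mult.assoc)
      then show ?thesis using A_eq[OF ly0] False y0 by simp
    qed (simp add: A0)
    then show "l \<in> K" by (simp add: K_def)
  qed
  \<comment> \<open>A nonzero difference of two multipliers permutes \<open>A\<close>, so equal
    values would put \<open>w\<close> into the kernel although \<open>h w = y0\<close>. Hence
    \<open>K\<close> is no larger than the image of \<open>h\<close>, that is, than
    \<open>J\<close>.\<close>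
  have "inj_on (\<lambda>l. h (l * w)) K"
  proof (rule inj_onI, rule ccontr)
    fix l l' assume l: "l \<in> K" "l' \<in> K" "h (l * w) = h (l' * w)" "l \<noteq> l'"
    define k where "k = l - l'"
    have k: "k \<noteq> 0" "k * w \<in> A" "(*) k ` A \<subseteq> A"
      using l by (auto simp: k_def A_def K_def left_diff_distrib sub)
    have "(*) k ` A = A"
      by (rule card_subset_eq) (use k in \<open>auto simp: card_image inj_on_def\<close>)
    with k(2) obtain a where "a \<in> A" "k * w = k * a" by blast
    with k(1) have "w \<in> A" by simp
    then show False using hw y0 by (simp add: A_def)
  qed
  then have "card K = card ((\<lambda>l. h (l * w)) ` K)" by (simp add: card_image)
  also have "\<dots> \<le> card (range h)" by (intro card_mono) auto
  also have "card (range h) = card J"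
    unfolding J_def using y0 by (subst card_image) (auto intro: inj_onI)
  finally have K_J: "K = J" using J_K by (metis card_seteq finite)

  have hJ: "h (l * w) = l * y0" if "l \<in> J" for l
    using hE[of e0 "l * y0"] e0 that y0 by (auto simp: w_def J_def mult.assoc)
  have "h (l * u) = l * h u" if "l \<in> J" for l u
  proof -
    \<comment> \<open>Modulo the kernel \<open>u\<close> is \<open>k * w\<close>, and multiplication
      by \<open>l\<close> keeps the kernel part in the kernel.\<close>
    define k where "k = h u / y0"
    have k: "k \<in> J" by (auto simp: k_def J_def)
    have "u - k * w \<in> A" using hJ[OF k] y0 by (simp add: A_def sub k_def)
    then have "l * (u - k * w) \<in> A" using that J_K by (auto simp: K_def)
    then have "h (l * u) = h ((l * k) * w)" by (simp add: A_def right_diff_distrib sub mult.assoc)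
    moreover have "l * k \<in> J" using that k unfolding K_J[symmetric] by (simp add: K_def mult.assoc)
    ultimately have "h (l * u) = l * k * y0" using hJ by simp
    then show ?thesis using y0 by (simp add: k_def)
  qed
  moreover have "h x / y0 \<in> J" for x unfolding J_def by (intro imageI rangeI)
  ultimately show ?thesis using y0 by blast
qed

subsection \<open>\<open>q\<close>-polynomials\<close>

lemma finite_field_power_card:
  fixes x :: "'a::{field,finite}"
  shows "x ^ CARD('a) = x"
proof (cases "x = 0")
  case False
  have "\<Prod>(UNIV - {0}) = (\<Prod>y\<in>UNIV - {0}. x * y)"
    by (rule prod.reindex_bij_witness[of _ "\<lambda>y. x * y" "\<lambda>y. y / x"]) (use False in auto)
  also have "\<dots> = x ^ (CARD('a) - 1) * \<Prod>(UNIV - {0})" by (simp add: prod.distrib)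
  finally have "x ^ (CARD('a) - 1) = 1" by simp
  then show ?thesis by (metis One_nat_def Suc_pred mult_1_right power_Suc zero_less_card_finite)
qed simp

lemma finite_field_frobenius_sum:
  fixes F :: "'b \<Rightarrow> 'a::{field,finite}"
  assumes "primepow q" and card: "CARD('a) = q ^ n"
  shows "sum F S ^ (q ^ i) = (\<Sum>s\<in>S. F s ^ (q ^ i))"
proof -
  obtain p k where p: "prime p" "k > 0" "q = p ^ k" using assms(1) by (auto simp: primepow_def)
  \<comment> \<open>Shifting by 1 permutes the field, so the field order vanishes as a field
    element. This makes the characteristic the prime dividing \<open>q\<close>.\<close>
  have "(\<Sum>x\<in>UNIV. x + 1) = (\<Sum>x\<in>UNIV. x :: 'a)"
    by (rule sum.reindex_bij_witness[of _ "\<lambda>x. x - 1" "\<lambda>x. x + 1"]) auto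
  then have "of_nat CARD('a) = (0 :: 'a)" by (simp add: sum.distrib)
  then have "CHAR('a) dvd (p ^ k) ^ n"
    using card p of_nat_eq_0_iff_char_dvd by metis
  moreover have prime: "prime CHAR('a)"
    using finite_imp_CHAR_pos[OF finite] by (rule prime_CHAR_semidom)
  ultimately have "CHAR('a) = p" using p by (metis prime_dvd_power primes_dvd_imp_eq)
  then show ?thesis
    by (intro freshmans_dream_sum'[where n = "k * i"]) (use prime p in \<open>auto simp: power_mult\<close>)
qed

lemma finite_field_frobenius_add:
  fixes x y :: "'a::{field,finite}"
  assumes "primepow q" and "CARD('a) = q ^ n"
  shows "(x + y) ^ (q ^ i) = x ^ (q ^ i) + y ^ (q ^ i)"
  using finite_field_frobenius_sum[OF assms, of "\<lambda>b. if b then x else y" UNIV i]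
  by (simp add: UNIV_bool add.commute)

text \<open>Both sides are polynomials of degree below the field order, so their values on the field
  determine the coefficients.\<close>

lemma q_polynomial_coeffs_unique:
  fixes a b :: "nat \<Rightarrow> 'a::{field,finite}"
  assumes "q > 1" and card: "CARD('a) = q ^ n"
    and eq: "\<And>x. (\<Sum>i<n. a i * x ^ (q ^ i)) = (\<Sum>i<n. b i * x ^ (q ^ i))"
    and "i < n"
  shows "a i = b i"
proof -
  define P where "P c = (\<Sum>i<n. monom (c i) (q ^ i))" for c :: "nat \<Rightarrow> 'a"
  have deg: "degree (P c) < CARD('a)" for c
    unfolding P_def using assms
    by (intro degree_sum_less) (auto intro: le_less_trans[OF degree_monom_le])
  have "P a = P b"
    by (rule poly_eqI_degree[of UNIV])
      (use deg eq in \<open>auto simp: P_def poly_sum poly_monom\<close>)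
  moreover have "coeff (P c) (q ^ i) = c i" for c
  proof -
    have "coeff (P c) (q ^ i) = (\<Sum>j<n. if j = i then c j else 0)"
      unfolding P_def coeff_sum using \<open>q > 1\<close> by (intro sum.cong) auto
    then show ?thesis using \<open>i < n\<close> by simp
  qed
  ultimately show ?thesis by metis
qed

lemma poly_q_polynomial:
  assumes "f \<in> q_polynomials n q"
  obtains a where "\<And>x. poly f x = (\<Sum>i<n. a i * x ^ (q ^ i))"
  using assms by (auto simp: q_polynomials_def poly_sum poly_monom)

lemma q_polynomial_add:
  fixes f :: "'a::{field,finite} poly"
  assumes "primepow q" and "CARD('a) = q ^ n" and "f \<in> q_polynomials n q"
  shows "poly f (x + y) = poly f x + poly f y"
proof -
  obtain a where "\<And>x. poly f x = (\<Sum>i<n. a i * x ^ (q ^ i))"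
    using poly_q_polynomial assms(3) by blast
  then show ?thesis
    by (simp add: finite_field_frobenius_add[OF assms(1,2)] distrib_left sum.distrib)
qed

lemma subfield_power:
  "c \<in> subfield_of_order m \<Longrightarrow> c ^ (m ^ i) = c"
  by (induction i) (auto simp: subfield_of_order_def power_mult)

lemma q_polynomial_scale:
  fixes f :: "'a::{field,finite} poly"
  assumes "f \<in> q_polynomials n q" and "c \<in> subfield_of_order q"
  shows "poly f (c * x) = c * poly f x"
proof -
  obtain a where "\<And>x. poly f x = (\<Sum>i<n. a i * x ^ (q ^ i))"
    using poly_q_polynomial assms(1) by blast
  then show ?thesis
    by (simp add: subfield_power[OF assms(2)] power_mult_distrib sum_distrib_left mult_ac)
qed

lemma q_polynomial_0: "primepow q \<Longrightarrow> f \<in> q_polynomials n q \<Longrightarrow> poly f 0 = 0"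
  using q_polynomial_scale[of f n q 0 0] primepow_gt_0_nat[of q]
  by (simp add: subfield_of_order_def)

text \<open>
  Comparing coefficients, \<open>f\<close> commutes with \<open>l\<close> iff \<open>l\<close> is fixed by the \<open>q\<^sup>i\<close>-power map for every \<open>i\<close>
  in the support of \<open>f\<close>; these \<open>i\<close> are then multiples of the least positive exponent fixing \<open>l\<close>.
\<close>

lemma max_field_of_linearity_scalar:
  fixes f :: "'a::{field,finite} poly"
  assumes "q > 1" and card: "CARD('a) = q ^ n" and "n > 0" and "f \<in> q_polynomials n q"
    and max: "max_field_of_linearity_is_base n q f"
    and comm: "\<And>x. poly f (l * x) = l * poly f x"
  shows "l \<in> subfield_of_order q"
proof -
  obtain a where a: "\<And>x. poly f x = (\<Sum>i<n. a i * x ^ (q ^ i))"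
    using poly_q_polynomial assms(4) by blast
  have "(\<Sum>i<n. (a i * l ^ (q ^ i)) * x ^ (q ^ i)) = (\<Sum>i<n. (l * a i) * x ^ (q ^ i))" for x
    using comm[of x] by (simp add: a power_mult_distrib sum_distrib_left mult_ac)
  then have "a i * l ^ (q ^ i) = l * a i" if "i < n" for i
    by (rule q_polynomial_coeffs_unique[OF assms(1,2)]) (fact that)
  then have supp: "l ^ (q ^ i) = l" if "i < n" "a i \<noteq> 0" for i
    using that by (metis mult.commute mult_left_cancel)
  define d where "d = (LEAST i. i > 0 \<and> l ^ (q ^ i) = l)"
  have ln: "l ^ (q ^ n) = l" using finite_field_power_card[of l] card by simp
  have d: "d > 0" "l ^ (q ^ d) = l"
    using LeastI[of "\<lambda>i. i > 0 \<and> l ^ (q ^ i) = l" n] \<open>n > 0\<close> ln by (auto simp: d_def)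
  \<comment> \<open>A nonzero remainder of \<open>i\<close> modulo \<open>d\<close> would be a
    smaller positive exponent fixing \<open>l\<close>.\<close>
  have d_dvd: "d dvd i" if "l ^ (q ^ i) = l" for i
  proof (rule ccontr)
    assume "\<not> d dvd i"
    then have pos: "i mod d > 0" by (simp add: dvd_eq_mod_eq_0)
    have "l \<in> subfield_of_order (q ^ d)" using d by (simp add: subfield_of_order_def)
    then have ld: "l ^ (q ^ (d * j)) = l" for j using subfield_power by (metis power_mult)
    have "l = l ^ (q ^ (d * (i div d) + i mod d))" using that by simp
    also have "\<dots> = (l ^ (q ^ (d * (i div d)))) ^ (q ^ (i mod d))"
      by (simp only: power_add power_mult)
    finally have "l ^ (q ^ (i mod d)) = l" by (simp add: ld)
    then have "d \<le> i mod d" unfolding d_def using pos by (intro Least_le) (simp add: d_def)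
    then show False using mod_less_divisor[OF d(1), of i] by simp
  qed
  \<comment> \<open>Maximality speaks about whole subfields, so commutation is extended from
    \<open>l\<close> to the field of order \<open>q ^ d\<close>.\<close>
  have "poly f (k * x) = k * poly f x" if "k \<in> subfield_of_order (q ^ d)" for k x
  proof -
    have "a i * (k * x) ^ (q ^ i) = k * (a i * x ^ (q ^ i))" if "i < n" for i
    proof (cases "a i = 0")
      case False
      then have "d dvd i" using d_dvd[OF supp] \<open>i < n\<close> by blast
      then obtain j where "i = d * j" by blast
      then have "k ^ (q ^ i) = k"
        using subfield_power[OF \<open>k \<in> subfield_of_order (q ^ d)\<close>] by (simp add: power_mult)
      then show ?thesis by (simp add: power_mult_distrib mult_ac)
    qed simp
    then show ?thesis unfolding a sum_distrib_left by (intro sum.cong) auto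
  qed
  then have "\<not> d > 1" using max d_dvd[OF ln] by (auto simp: max_field_of_linearity_is_base_def)
  with d show ?thesis by (simp add: subfield_of_order_def not_less le_Suc_eq)
qed

text \<open>A value in the field of order \<open>q\<close> is fixed by the \<open>q\<close>-th
  power, which raises the coefficients to the \<open>q\<close>-th power and shifts them cyclically.
  So each coefficient is the \<open>q\<close>-th power of its predecessor, and the map is the trace
  of \<open>c 0 * x\<close>.\<close>

lemma q_polynomial_subfield_valued:
  fixes c :: "nat \<Rightarrow> 'a::{field,finite}"
  assumes q: "primepow q" and card: "CARD('a) = q ^ n"
    and val: "\<And>x. (\<Sum>i<n. c i * x ^ (q ^ i)) \<in> subfield_of_order q"
  shows "(\<Sum>i<n. c i * x ^ (q ^ i)) = (\<Sum>i<n. (c 0 * x) ^ (q ^ i))"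
proof (cases n)
  case (Suc m)
  \<comment> \<open>Coefficients of the \<open>q\<close>-th power of the sum; the top term wraps
    around to index 0 because \<open>x ^ (q ^ n) = x\<close>.\<close>
  define b where "b i = (case i of 0 \<Rightarrow> c m ^ q | Suc j \<Rightarrow> c j ^ q)" for i
  have "(\<Sum>i<n. c i * x ^ (q ^ i)) = (\<Sum>i<n. b i * x ^ (q ^ i))" for x
  proof -
    have "(\<Sum>i<n. c i * x ^ (q ^ i)) = (\<Sum>i<n. c i * x ^ (q ^ i)) ^ q"
      using val by (simp add: subfield_of_order_def)
    also have "\<dots> = (\<Sum>i<n. (c i * x ^ (q ^ i)) ^ q)"
      using finite_field_frobenius_sum[OF q card, of _ _ 1] by simp
    also have "\<dots> = (\<Sum>i<n. c i ^ q * x ^ (q ^ Suc i))"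
      by (simp add: power_mult_distrib mult.commute[of q] flip: power_mult)
    also have "\<dots> = (\<Sum>i<m. c i ^ q * x ^ (q ^ Suc i)) + c m ^ q * x"
      using finite_field_power_card[of x] by (simp add: Suc card)
    also have "\<dots> = (\<Sum>i<n. b i * x ^ (q ^ i))"
      unfolding Suc sum.lessThan_Suc_shift by (simp add: b_def)
    finally show ?thesis .
  qed
  then have cb: "c i = b i" if "i < n" for i
    using q_polynomial_coeffs_unique[OF _ card] primepow_gt_Suc_0[OF q] that by simp
  have c: "c i = c 0 ^ (q ^ i)" if "i < n" for i
    using that
  proof (induction i)
    case (Suc i)
    then show ?case using cb[of "Suc i"] by (simp add: b_def mult.commute flip: power_mult)
  qed simp
  have "c i * x ^ (q ^ i) = (c 0 * x) ^ (q ^ i)" if "i < n" for i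
    by (subst c[OF that]) (simp add: power_mult_distrib)
  then show ?thesis by (intro sum.cong) auto
qed simp

text \<open>By \<open>count\<close>, the line \<open>a x + b y + c z = 0\<close> has as many affine
  points of the set as the set has points at infinity off that line. Subtracting the slope
  \<open>p\<close> turns this into the hypothesis of \<open>additive_with_few_slopes\<close>.
  Maximality then puts the values \<open>h x / y\<close> into the field of order \<open>q\<close>,
  so they are given by a trace.\<close>

lemma q_polynomial_second_long_secant:
  fixes f :: "'a::{field,finite} poly"
  assumes q: "primepow q" and n: "n \<ge> 2" and card: "CARD('a) = q ^ n"
    and f: "f \<in> q_polynomials n q" and max: "max_field_of_linearity_is_base n q f"
    and ab: "(a, b) \<noteq> (0, 0)"
    and count: "card {x. a * x + b * poly f x + c = 0}
      = card {m. (\<exists>x. x \<noteq> 0 \<and> poly f x = m * x) \<and> a + b * m \<noteq> 0}"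
  shows "\<exists>p y d. y \<noteq> 0 \<and> d \<noteq> 0 \<and> (\<forall>x. poly f x = p * x + y * (\<Sum>i<n. (d * x) ^ (q ^ i)))"
proof -
  have q1: "q > 1" using primepow_gt_Suc_0[OF q] by simp
  note add = q_polynomial_add[OF q card f]
  have f0: "poly f 0 = 0" using q f by (rule q_polynomial_0)
  \<comment> \<open>A scalar map is linear over the whole field, which maximality excludes through
    the divisor \<open>d = n\<close>.\<close>
  have not_scalar: "\<not> (\<forall>x. poly f x = m * x)" for m
    using max n unfolding max_field_of_linearity_is_base_def
    by (metis One_nat_def Suc_1 Suc_le_lessD dvd_refl mult.left_commute)
  define D where "D = {m. \<exists>x. x \<noteq> 0 \<and> poly f x = m * x}"
  have D_mem: "poly f x / x \<in> D" if "x \<noteq> 0" for x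
    using that by (auto simp: D_def intro!: exI[of _ x])
  \<comment> \<open>A line through \<open>(0, 1, 0)\<close> other than \<open>z = 0\<close> has one
    affine point of the set, so \<open>f\<close> would have a single slope and be a scalar
    map.\<close>
  have b: "b \<noteq> 0"
  proof
    assume "b = 0"
    with ab have "a \<noteq> 0" by simp
    then have "{x. a * x + b * poly f x + c = 0} = {- c / a}"
      using \<open>b = 0\<close> by (auto simp: field_simps eq_neg_iff_add_eq_0)
    with count have "card D = 1" using \<open>a \<noteq> 0\<close> \<open>b = 0\<close> by (simp add: D_def)
    then obtain m where "D = {m}" by (auto simp: card_1_singleton_iff)
    then have "poly f x = m * x" for x
      using D_mem[of x] f0 by (cases "x = 0") (auto simp: field_simps)
    then show False using not_scalar by blast
  qed
  define p where "p = - a / b"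
  define h where "h x = poly f x - p * x" for x
  have h_add: "h (x + y) = h x + h y" for x y by (simp add: h_def add algebra_simps)
  have h0: "h 0 = 0" by (simp add: h_def f0)
  have h_nz: "\<exists>x. h x \<noteq> 0" using not_scalar[of p] by (auto simp: h_def)
  define M where "M = {m. m \<noteq> 0 \<and> (\<exists>x. x \<noteq> 0 \<and> h x = m * x)}"
  have "{m. (\<exists>x. x \<noteq> 0 \<and> poly f x = m * x) \<and> a + b * m \<noteq> 0} = (+) p ` M" (is "?L = _")
  proof -
    have "a + b * m \<noteq> 0 \<longleftrightarrow> m - p \<noteq> 0" for m
      using b by (simp add: p_def field_simps eq_neg_iff_add_eq_0)
    moreover have "poly f x = m * x \<longleftrightarrow> h x = (m - p) * x" for x m
      by (simp add: h_def algebra_simps)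
    ultimately have "m \<in> ?L \<longleftrightarrow> m - p \<in> M" for m
      by (simp add: M_def conj_commute)
    then show ?thesis by (force simp: image_iff)
  qed
  then have card_M: "card M = card {x. a * x + b * poly f x + c = 0}"
    by (simp add: count card_image)
  have S: "{x. a * x + b * poly f x + c = 0} = {x. h x = - c / b}"
    using b by (auto simp: h_def p_def field_simps eq_neg_iff_add_eq_0 neg_eq_iff_add_eq_0)
  \<comment> \<open>A nonzero value of \<open>h\<close> gives a nonzero slope, so the fibre over
    \<open>- c / b\<close> is nonempty and hence a coset of the kernel.\<close>
  obtain x1 where x1: "h x1 \<noteq> 0" using h_nz by blast
  then have "h x1 / x1 \<in> M" using h0 by (auto simp: M_def intro!: exI[of _ x1])
  then have "card {x. h x = - c / b} \<noteq> 0" unfolding S[symmetric] card_M[symmetric] by auto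
  then obtain x2 where x2: "h x2 = - c / b" by fastforce
  have "{x. h x = - c / b} = (+) x2 ` {x. h x = 0}"
  proof -
    have "h x = - c / b \<longleftrightarrow> h (x - x2) = 0" for x
      using h_add[of "x - x2" x2] x2 by simp
    then show ?thesis by (force simp: image_iff)
  qed
  then have "card M = card {x. h x = 0}" by (simp add: card_M S card_image)
  then obtain y where y: "y \<noteq> 0" and lin: "\<And>x u. h (h x / y * u) = h x / y * h u"
    using additive_with_few_slopes[of h, OF h_add] unfolding M_def by blast
  have lin_f: "poly f (l * u) = l * poly f u" if "h (l * u) = l * h u" for l u
    using that by (simp add: h_def algebra_simps)
  have val: "h x / y \<in> subfield_of_order q" for x
  proof (rule max_field_of_linearity_scalar[OF q1 card _ f max])
    show "poly f (h x / y * u) = h x / y * poly f u" for u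
      using lin by (rule lin_f)
  qed (use n in simp)
  obtain e where e: "\<And>x. poly f x = (\<Sum>i<n. e i * x ^ (q ^ i))"
    using poly_q_polynomial[OF f] by blast
  \<comment> \<open>Subtracting \<open>p * x\<close> changes only the coefficient of index 0, so
    \<open>h x / y\<close> again has the shape of a \<open>q\<close>-polynomial.\<close>
  define r where "r i = (if i = 0 then e 0 - p else e i) / y" for i
  obtain k where k: "n = Suc k" using n by (cases n) auto
  have r: "h x / y = (\<Sum>i<n. r i * x ^ (q ^ i))" for x
    by (simp add: h_def e r_def k sum.lessThan_Suc_shift sum_divide_distrib
        add_divide_distrib diff_divide_distrib left_diff_distrib del: sum.lessThan_Suc)
  have hr: "h x / y = (\<Sum>i<n. (r 0 * x) ^ (q ^ i))" for x
    unfolding r by (rule q_polynomial_subfield_valued[OF q card]) (use val r in metis)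
  have "r 0 \<noteq> 0"
  proof
    assume "r 0 = 0"
    then have "h x = 0" for x using hr[of x] y q1 by (simp add: power_0_left)
    then show False using h_nz by blast
  qed
  moreover have "poly f x = p * x + y * (\<Sum>i<n. (r 0 * x) ^ (q ^ i))" for x
    using hr[of x] y by (simp add: h_def field_simps)
  ultimately show ?thesis using y by blast
qed

subsection \<open>Semilinear bijections\<close>

text \<open>Keeping the companion automorphism as a parameter lets one argument serve both
  equivalences: \<open>GL\<close> is the case \<open>id\<close>, and \<open>GammaL\<close>
  quantifies over \<open>\<sigma>\<close>.\<close>

definition semilinear_bij :: "('a::field \<Rightarrow> 'a) \<Rightarrow> ('a ^ 'm \<Rightarrow> 'a ^ 'm) \<Rightarrow> bool" where
  "semilinear_bij \<sigma> \<phi> \<longleftrightarrow> bij \<phi> \<and> (\<forall>v w. \<phi> (v + w) = \<phi> v + \<phi> w) \<and> (\<forall>c v. \<phi> (c *s v) = \<sigma> c *s \<phi> v)"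

lemma GammaL_iff: "\<phi> \<in> GammaL \<longleftrightarrow> (\<exists>\<sigma>. field_automorphism \<sigma> \<and> semilinear_bij \<sigma> \<phi>)"
  by (auto simp: GammaL_def semilinear_bij_def)

lemma GL_iff: "\<phi> \<in> GL \<longleftrightarrow> semilinear_bij id \<phi>"
  by (auto simp: GL_def semilinear_bij_def Vector_Spaces.linear_iff vec.vector_space_axioms)

lemma equivalent_under_GammaL_iff:
  "equivalent_under GammaL X Y \<longleftrightarrow> (\<exists>\<sigma> \<phi>. field_automorphism \<sigma> \<and> semilinear_bij \<sigma> \<phi> \<and> \<phi> ` X = Y)"
  unfolding equivalent_under_def Bex_def GammaL_iff by metis

lemma equivalent_under_GL_iff:
  "equivalent_under GL X Y \<longleftrightarrow> (\<exists>\<phi>. semilinear_bij id \<phi> \<and> \<phi> ` X = Y)"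
  unfolding equivalent_under_def Bex_def GL_iff by metis

lemma equivalent_under_PGammaL_iff:
  "equivalent_under PGammaL X Y
    \<longleftrightarrow> (\<exists>\<sigma> \<phi>. field_automorphism \<sigma> \<and> semilinear_bij \<sigma> \<phi> \<and> restrict (image \<phi>) proj_points ` X = Y)"
  unfolding equivalent_under_def Bex_def PGammaL_def mem_Collect_eq GammaL_iff by metis

lemma equivalent_under_PGL_iff:
  "equivalent_under PGL X Y
    \<longleftrightarrow> (\<exists>\<phi>. semilinear_bij id \<phi> \<and> restrict (image \<phi>) proj_points ` X = Y)"
  unfolding equivalent_under_def Bex_def PGL_def mem_Collect_eq GL_iff by metis

lemma field_automorphism_id: "field_automorphism id"
  by (simp add: field_automorphism_def)

lemma field_automorphism_0_1:
  assumes "field_automorphism \<sigma>"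
  shows "\<sigma> 0 = 0" "\<sigma> 1 = 1" "\<sigma> x = 0 \<longleftrightarrow> x = 0"
proof -
  have \<sigma>: "bij \<sigma>" "\<And>x y. \<sigma> (x + y) = \<sigma> x + \<sigma> y" "\<And>x y. \<sigma> (x * y) = \<sigma> x * \<sigma> y"
    using assms by (auto simp: field_automorphism_def)
  show 0: "\<sigma> 0 = 0" using \<sigma>(2)[of 0 0] by (metis add_0 add_cancel_right_right)
  then show iff: "\<sigma> x = 0 \<longleftrightarrow> x = 0" for x using \<sigma>(1) by (metis bij_pointE)
  show "\<sigma> 1 = 1" using \<sigma>(3)[of 1 1] iff[of 1] by simp
qed

lemma field_automorphism_inv:
  assumes "field_automorphism \<sigma>"
  shows "field_automorphism (inv \<sigma>)"
proof -
  have \<sigma>: "bij \<sigma>" "\<And>x y. \<sigma> (x + y) = \<sigma> x + \<sigma> y" "\<And>x y. \<sigma> (x * y) = \<sigma> x * \<sigma> y"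
    using assms by (auto simp: field_automorphism_def)
  have "inv \<sigma> (x + y) = inv \<sigma> x + inv \<sigma> y" "inv \<sigma> (x * y) = inv \<sigma> x * inv \<sigma> y" for x y
    by (rule inv_f_eq; simp add: \<sigma> bij_is_inj bij_is_surj surj_f_inv_f)+
  then show ?thesis using \<sigma>(1) by (simp add: field_automorphism_def bij_imp_bij_inv)
qed

lemma semilinear_bij_inv:
  assumes "field_automorphism \<sigma>" and "semilinear_bij \<sigma> \<phi>"
  shows "semilinear_bij (inv \<sigma>) (inv \<phi>)"
proof -
  have \<phi>: "bij \<phi>" "\<And>v w. \<phi> (v + w) = \<phi> v + \<phi> w" "\<And>c v. \<phi> (c *s v) = \<sigma> c *s \<phi> v"
    and \<sigma>: "bij \<sigma>"
    using assms by (auto simp: field_automorphism_def semilinear_bij_def)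
  have "inv \<phi> (v + w) = inv \<phi> v + inv \<phi> w" "inv \<phi> (c *s v) = inv \<sigma> c *s inv \<phi> v" for c v w
    by (rule inv_f_eq; simp add: \<phi> \<sigma> bij_is_inj bij_is_surj surj_f_inv_f)+
  then show ?thesis using \<phi>(1) by (simp add: semilinear_bij_def bij_imp_bij_inv)
qed

lemma semilinear_bijI:
  fixes \<phi> :: "'a::{field,finite} ^ 'm \<Rightarrow> 'a ^ 'm"
  assumes "inj \<phi>" and "\<And>v w. \<phi> (v + w) = \<phi> v + \<phi> w" and "\<And>c v. \<phi> (c *s v) = \<sigma> c *s \<phi> v"
  shows "semilinear_bij \<sigma> \<phi>"
  using assms by (simp add: semilinear_bij_def bij_def finite_UNIV_inj_surj)

lemma semilinear_bij_0: "semilinear_bij \<sigma> \<phi> \<Longrightarrow> \<phi> 0 = 0"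
  unfolding semilinear_bij_def by (metis add_0 add_cancel_right_right)

lemma semilinear_bij_span:
  assumes "field_automorphism \<sigma>" and "semilinear_bij \<sigma> \<phi>"
  shows "\<phi> ` vec.span {v} = vec.span {\<phi> v}"
proof -
  have "range \<sigma> = UNIV" using assms(1) by (simp add: field_automorphism_def bij_is_surj)
  then have "range (\<lambda>k. k *s \<phi> v) = (\<lambda>k. k *s \<phi> v) ` range \<sigma>" by simp
  then show ?thesis using assms(2)
    by (simp add: vec.span_singleton image_image semilinear_bij_def)
qed

lemma span_singleton_eq:
  fixes v w :: "'a::field ^ 'm"
  assumes "vec.span {v} = vec.span {w}" and "v \<noteq> 0"
  shows "\<exists>k. k \<noteq> 0 \<and> v = k *s w"
proof -
  have "v \<in> vec.span {w}" using assms(1) vec.span_base[of v "{v}"] by simp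
  then obtain k where "v = k *s w" by (auto simp: vec.span_singleton)
  with assms(2) show ?thesis by auto
qed

lemma span_scale:
  fixes v :: "'a::field ^ 'm"
  assumes "k \<noteq> 0"
  shows "vec.span {k *s v} = vec.span {v}"
proof -
  have "range (\<lambda>l. l * k) = UNIV"
    using assms by (intro surjI[of _ "\<lambda>l. l / k"]) simp
  then have "range (\<lambda>l. l *s v) = (\<lambda>l. l *s v) ` range (\<lambda>l. l * k)" by simp
  then show ?thesis by (simp add: vec.span_singleton image_image vector_smult_assoc)
qed

subsection \<open>The cone over the point set\<close>

text \<open>The nonzero vectors spanning the points of \<open>B_set q f\<close>, see \<open>B_set_eq\<close>.\<close>

definition B_cone :: "'a::{field,finite} poly \<Rightarrow> ('a ^ 3) set" where
  "B_cone f = {c *s vector [x, poly f x, \<alpha>] | c x \<alpha>. c \<noteq> 0 \<and> \<alpha> \<in> {0, 1} \<and> (x, \<alpha>) \<noteq> (0, 0)}"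

lemma vector_3_eq_iff: "v = w \<longleftrightarrow> v $ 1 = w $ 1 \<and> v $ 2 = w $ 2 \<and> v $ (3::3) = w $ 3"
  by (simp add: vec_eq_iff forall_3)

lemma vector_2_eq_iff: "v = w \<longleftrightarrow> v $ 1 = w $ 1 \<and> v $ (2::2) = w $ 2"
  by (simp add: vec_eq_iff forall_2)

lemma B_cone_nonzero: "v \<in> B_cone f \<Longrightarrow> v \<noteq> 0"
  by (auto simp: B_cone_def vector_3_eq_iff)

lemma B_cone_scale: "k \<noteq> 0 \<Longrightarrow> v \<in> B_cone f \<Longrightarrow> k *s v \<in> B_cone f"
  unfolding B_cone_def by clarsimp (metis mult_eq_0_iff vector_smult_assoc)

lemma B_cone_affine_iff:
  assumes "v $ 3 \<noteq> 0"
  shows "v \<in> B_cone f \<longleftrightarrow> poly f (v $ 1 / v $ 3) = v $ 2 / v $ 3"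
proof
  assume "v \<in> B_cone f"
  with assms show "poly f (v $ 1 / v $ 3) = v $ 2 / v $ 3" by (auto simp: B_cone_def)
next
  assume *: "poly f (v $ 1 / v $ 3) = v $ 2 / v $ 3"
  have "v = v $ 3 *s vector [v $ 1 / v $ 3, poly f (v $ 1 / v $ 3), 1]"
    using assms * by (simp add: vector_3_eq_iff)
  then show "v \<in> B_cone f"
    using assms unfolding B_cone_def mem_Collect_eq by (metis insertCI prod.inject zero_neq_one)
qed

lemma B_cone_infinity_iff:
  assumes "v $ 3 = 0" and "poly f 0 = 0"
  shows "v \<in> B_cone f \<longleftrightarrow> v $ 1 \<noteq> 0 \<and> (\<exists>x. x \<noteq> 0 \<and> poly f x = v $ 2 / v $ 1 * x)"
proof
  assume "v \<in> B_cone f"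
  with assms show "v $ 1 \<noteq> 0 \<and> (\<exists>x. x \<noteq> 0 \<and> poly f x = v $ 2 / v $ 1 * x)"
    by (auto simp: B_cone_def)
next
  assume "v $ 1 \<noteq> 0 \<and> (\<exists>x. x \<noteq> 0 \<and> poly f x = v $ 2 / v $ 1 * x)"
  then obtain x where x: "v $ 1 \<noteq> 0" "x \<noteq> 0" "poly f x = v $ 2 / v $ 1 * x" by blast
  then have "v = (v $ 1 / x) *s vector [x, poly f x, 0]" "v $ 1 / x \<noteq> 0"
    using assms by (simp_all add: vector_3_eq_iff)
  with x show "v \<in> B_cone f" unfolding B_cone_def by blast
qed

text \<open>A nonzero \<open>\<alpha>\<close> in the field of order \<open>q\<close> can be scaled
  to 1 because \<open>f\<close> commutes with that scaling. Up to scalars only the third coordinates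
  0 and 1 remain.\<close>

lemma B_set_eq:
  assumes "\<And>c x. c \<in> subfield_of_order q \<Longrightarrow> poly f (c * x) = c * poly f x" and "q > 0"
  shows "B_set q f = (\<lambda>v. vec.span {v}) ` B_cone f"
proof (intro equalityI subsetI)
  fix P assume "P \<in> B_set q f"
  then obtain x \<alpha> where P: "P = vec.span {vector [x, poly f x, \<alpha>]}"
    "\<alpha> \<in> subfield_of_order q" "(x, \<alpha>) \<noteq> (0, 0)" by (auto simp: B_set_def)
  have "vector [x, poly f x, \<alpha>] \<in> B_cone f"
  proof (cases "\<alpha> = 0")
    case True
    have "vector [x, poly f x, \<alpha>] = 1 *s (vector [x, poly f x, 0] :: 'a ^ 3)"
      by (simp add: True)
    then show ?thesis using P True unfolding B_cone_def
      by (metis (mono_tags, lifting) insertI1 mem_Collect_eq zero_neq_one)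
  next
    case False
    have "poly f x = \<alpha> * poly f (x / \<alpha>)" using assms(1)[OF P(2), of "x / \<alpha>"] False by simp
    with False show ?thesis by (simp add: B_cone_affine_iff)
  qed
  with P show "P \<in> (\<lambda>v. vec.span {v}) ` B_cone f" by blast
next
  fix P assume "P \<in> (\<lambda>v. vec.span {v}) ` B_cone f"
  then obtain c x \<alpha> where "P = vec.span {c *s vector [x, poly f x, \<alpha>]}"
    "c \<noteq> 0" "\<alpha> \<in> {0, 1}" "(x, \<alpha>) \<noteq> (0, 0)" by (auto simp: B_cone_def)
  moreover have "{0, 1} \<subseteq> subfield_of_order q" using assms(2) by (simp add: subfield_of_order_def)
  ultimately show "P \<in> B_set q f" by (auto simp: B_set_def span_scale)
qed

lemma span_in_B_cone_iff:
  assumes "v \<noteq> 0"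
  shows "vec.span {v} \<in> (\<lambda>v. vec.span {v}) ` B_cone f \<longleftrightarrow> v \<in> B_cone f"
  using span_singleton_eq[OF _ assms] B_cone_scale by blast

text \<open>The cone is closed under nonzero scalars and \<open>\<psi>\<close> is injective, so
  equality of point sets can be tested vector by vector. Cone vectors are nonzero, so their spans
  lie in \<open>proj_points\<close>.\<close>

lemma B_set_image_iff:
  assumes \<sigma>: "field_automorphism \<sigma>" and \<psi>: "semilinear_bij \<sigma> \<psi>"
    and f: "B_set q f = (\<lambda>v. vec.span {v}) ` B_cone f"
    and g: "B_set q g = (\<lambda>v. vec.span {v}) ` B_cone g"
  shows "restrict (image \<psi>) proj_points ` B_set q f = B_set q g
    \<longleftrightarrow> (\<forall>v. v \<in> B_cone f \<longleftrightarrow> \<psi> v \<in> B_cone g)"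
proof -
  have inj: "inj \<psi>" and surj: "surj \<psi>" using \<psi> by (auto simp: semilinear_bij_def bij_def)
  have "restrict (image \<psi>) proj_points ` B_set q f = (\<lambda>v. \<psi> ` vec.span {v}) ` B_cone f"
    unfolding f image_image
    by (intro image_cong refl) (use B_cone_nonzero in \<open>auto simp: proj_points_def\<close>)
  also have "\<dots> = (\<lambda>v. vec.span {\<psi> v}) ` B_cone f"
    by (simp add: semilinear_bij_span[OF \<sigma> \<psi>])
  finally have img: "restrict (image \<psi>) proj_points ` B_set q f = (\<lambda>v. vec.span {\<psi> v}) ` B_cone f" .
  have nz: "\<psi> v \<noteq> 0" if "v \<in> B_cone f" for v
    using B_cone_nonzero[OF that] semilinear_bij_0[OF \<psi>] inj by (metis injD)
  show ?thesis unfolding img g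
  proof
    assume eq: "(\<lambda>v. vec.span {\<psi> v}) ` B_cone f = (\<lambda>v. vec.span {v}) ` B_cone g"
    show "\<forall>v. v \<in> B_cone f \<longleftrightarrow> \<psi> v \<in> B_cone g"
    proof (intro allI iffI)
      fix v assume "v \<in> B_cone f"
      then have "vec.span {\<psi> v} \<in> (\<lambda>v. vec.span {v}) ` B_cone g" using eq by blast
      then show "\<psi> v \<in> B_cone g" using span_in_B_cone_iff nz[OF \<open>v \<in> B_cone f\<close>] by blast
    next
      fix v assume v: "\<psi> v \<in> B_cone g"
      then obtain w where w: "w \<in> B_cone f" "vec.span {\<psi> v} = vec.span {\<psi> w}"
        using eq by (metis (no_types, lifting) image_iff)
      have "\<psi> ` vec.span {v} = \<psi> ` vec.span {w}"
        using w by (simp add: semilinear_bij_span[OF \<sigma> \<psi>])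
      then have "vec.span {v} = vec.span {w}" using inj by (simp add: inj_image_eq_iff)
      moreover have "v \<noteq> 0" using B_cone_nonzero[OF v] semilinear_bij_0[OF \<psi>] by auto
      ultimately show "v \<in> B_cone f" using span_in_B_cone_iff w by blast
    qed
  next
    assume iff: "\<forall>v. v \<in> B_cone f \<longleftrightarrow> \<psi> v \<in> B_cone g"
    have "w \<in> \<psi> ` B_cone f" if "w \<in> B_cone g" for w
      using that iff surj by (metis image_eqI surjD)
    then have "B_cone g = \<psi> ` B_cone f" using iff by blast
    then show "(\<lambda>v. vec.span {\<psi> v}) ` B_cone f = (\<lambda>v. vec.span {v}) ` B_cone g"
      by (simp add: image_image)
  qed
qed

section \<open>Graphs, and projectivities that preserve the line at infinity\<close>

lemma card_U_set: "card (U_set f :: ('a::{field,finite} ^ 2) set) = CARD('a)"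
proof -
  have "U_set f = range (\<lambda>x. vector [x, poly f x])" by (auto simp: U_set_def)
  moreover have "inj (\<lambda>x. vector [x, poly f x] :: 'a ^ 2)"
    by (auto intro!: injI simp: vector_2_eq_iff)
  ultimately show ?thesis by (simp add: card_image)
qed

lemma U_set_iff: "u \<in> U_set f \<longleftrightarrow> u $ 2 = poly f (u $ 1)"
  by (auto simp: U_set_def vector_2_eq_iff)

text \<open>Graphs over the same finite field have equal size, so an injection of one into the other
  is onto.\<close>

lemma U_set_image_eqI:
  fixes f g :: "'a::{field,finite} poly"
  assumes "inj \<phi>" and "\<And>x. \<phi> (vector [x, poly f x]) \<in> U_set g"
  shows "\<phi> ` U_set f = U_set g"
proof (rule card_subset_eq)
  show "\<phi> ` U_set f \<subseteq> U_set g" using assms(2) by (auto simp: U_set_def)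
  show "card (\<phi> ` U_set f) = card (U_set g)"
    using assms(1) by (simp add: card_image inj_on_subset card_U_set)
qed simp

lemma B_cone_affine_image:
  fixes f g :: "'a::{field,finite} poly"
  assumes \<sigma>: "field_automorphism \<sigma>" and \<psi>: "semilinear_bij \<sigma> \<psi>"
    and f0: "poly f 0 = 0" and g_add: "\<And>x y. poly g (x + y) = poly g x + poly g y"
    and cone: "\<And>v. v \<in> B_cone f \<Longrightarrow> \<psi> v \<in> B_cone g"
    and inf: "\<And>v. v $ 3 = 0 \<Longrightarrow> \<psi> v $ 3 = 0"
  shows "\<exists>\<phi>. semilinear_bij \<sigma> \<phi> \<and> \<phi> ` U_set f = U_set g"
proof -
  \<comment> \<open>Third coordinates are mapped by \<open>\<sigma>\<close> and multiplied by
    \<open>c\<close>, so dividing by \<open>c\<close> returns the images of affine points to the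
    chart \<open>z = 1\<close>.\<close>
  define c where "c = \<psi> (vector [0, 0, 1]) $ 3"
  define L where "L u = (vector [u $ 1, u $ 2, 0] :: 'a ^ 3)" for u :: "'a ^ 2"
  define \<phi> where "\<phi> u = (vector [\<psi> (L u) $ 1 / c, \<psi> (L u) $ 2 / c] :: 'a ^ 2)" for u
  have add: "\<psi> (v + w) = \<psi> v + \<psi> w" and scale: "\<psi> (k *s v) = \<sigma> k *s \<psi> v" for v w k
    using \<psi> by (auto simp: semilinear_bij_def)
  have inj: "inj \<psi>" and surj: "surj \<psi>" using \<psi> by (auto simp: semilinear_bij_def bij_def)
  have third: "\<psi> v $ 3 = \<sigma> (v $ 3) * c" for v
  proof -
    have v: "v = vector [v $ 1, v $ 2, 0] + v $ 3 *s vector [0, 0, 1]"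
      by (simp add: vector_3_eq_iff)
    have "\<psi> v $ 3 = \<psi> (vector [v $ 1, v $ 2, 0]) $ 3 + \<sigma> (v $ 3) * c"
      by (subst v) (simp add: add scale c_def)
    then show ?thesis using inf by simp
  qed
  have c: "c \<noteq> 0"
  proof
    assume "c = 0"
    obtain v where "vector [0, 0, 1] = \<psi> v" using surj by (meson surjD)
    then have "\<psi> v $ 3 = 1" by (metis vector_3(3))
    with third[of v] \<open>c = 0\<close> show False by simp
  qed
  have L: "L (u + v) = L u + L v" "L (k *s u) = k *s L u" for u v k
    by (simp_all add: L_def vector_3_eq_iff)
  have \<phi>_add: "\<phi> (u + v) = \<phi> u + \<phi> v" for u v
    by (simp add: \<phi>_def L add vector_2_eq_iff add_divide_distrib)
  have \<phi>_scale: "\<phi> (k *s u) = \<sigma> k *s \<phi> u" for k u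
    by (simp add: \<phi>_def L scale vector_2_eq_iff)
  have \<phi>_inj: "inj \<phi>"
  proof (rule injI)
    fix u v assume "\<phi> u = \<phi> v"
    then have "\<psi> (L u) = \<psi> (L v)" using c by (simp add: \<phi>_def vector_2_eq_iff vector_3_eq_iff third L_def)
    then have "L u = L v" using inj by (simp add: inj_eq)
    then show "u = v" by (simp add: L_def vector_2_eq_iff vector_3_eq_iff)
  qed
  then have semi: "semilinear_bij \<sigma> \<phi>"
    using \<phi>_add \<phi>_scale by (rule semilinear_bijI)
  define t where "t = (vector [\<psi> (vector [0, 0, 1]) $ 1 / c, \<psi> (vector [0, 0, 1]) $ 2 / c] :: 'a ^ 2)"
  have translate: "\<phi> (vector [x, poly f x]) + t \<in> U_set g" for x
  proof -
    let ?w = "vector [x, poly f x, 1] :: 'a ^ 3"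
    have w: "?w = L (vector [x, poly f x]) + vector [0, 0, 1]"
      by (simp add: L_def vector_3_eq_iff)
    have "\<psi> ?w $ 3 = c" using field_automorphism_0_1[OF \<sigma>] by (simp add: third)
    moreover have "\<psi> ?w \<in> B_cone g" by (rule cone) (simp add: B_cone_affine_iff)
    ultimately have "poly g (\<psi> ?w $ 1 / c) = \<psi> ?w $ 2 / c" using c by (simp add: B_cone_affine_iff)
    then show ?thesis unfolding w
      by (simp add: U_set_iff \<phi>_def t_def add add_divide_distrib)
  qed
  \<comment> \<open>The origin lies on the graph of \<open>f\<close>, so its image \<open>t\<close>
    lies on the graph of \<open>g\<close>, and additivity of \<open>g\<close> removes the
    translation.\<close>
  have "\<phi> 0 = 0" using semi by (rule semilinear_bij_0)
  moreover have "vector [0, poly f 0] = (0 :: 'a ^ 2)" by (simp add: f0 vector_2_eq_iff)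
  ultimately have "t \<in> U_set g" using translate[of 0] by simp
  then have "\<phi> (vector [x, poly f x]) \<in> U_set g" for x
    using translate[of x] by (simp add: U_set_iff g_add)
  then have "\<phi> ` U_set f = U_set g" by (rule U_set_image_eqI[OF \<phi>_inj])
  with semi show ?thesis by blast
qed

section \<open>Counting cone vectors, and projectivities that move the line at infinity\<close>

lemma card_B_cone_affine_part:
  fixes f :: "'a::{field,finite} poly"
  shows "card {v \<in> B_cone f. v $ 3 \<noteq> 0 \<and> v $ 1 / v $ 3 \<in> S} = card S * (CARD('a) - 1)"
proof -
  have "{v \<in> B_cone f. v $ 3 \<noteq> 0 \<and> v $ 1 / v $ 3 \<in> S}
    = (\<lambda>(x, z). z *s vector [x, poly f x, 1]) ` (S \<times> (UNIV - {0}))" (is "?L = ?F ` ?R")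
  proof (intro equalityI subsetI)
    fix v assume v: "v \<in> ?L"
    then have "v = ?F (v $ 1 / v $ 3, v $ 3)"
      using B_cone_affine_iff[of v f] by (simp add: vector_3_eq_iff)
    with v show "v \<in> ?F ` ?R" by blast
  qed (auto simp: B_cone_affine_iff)
  moreover have "inj_on ?F ?R" by (auto intro!: inj_onI simp: vector_3_eq_iff)
  ultimately show ?thesis by (simp add: card_image card_cartesian_product)
qed

text \<open>A cone vector at infinity is determined by its slope and its nonzero first coordinate,
  as an affine one is by its chart coordinate and its third coordinate.\<close>

lemma card_B_cone_infinity_part:
  fixes f :: "'a::{field,finite} poly"
  assumes "poly f 0 = 0"
  shows "card {v \<in> B_cone f. v $ 3 = 0 \<and> v $ 2 / v $ 1 \<in> S}
    = card {m \<in> S. \<exists>x. x \<noteq> 0 \<and> poly f x = m * x} * (CARD('a) - 1)"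
proof -
  define D where "D = {m \<in> S. \<exists>x. x \<noteq> 0 \<and> poly f x = m * x}"
  have "{v \<in> B_cone f. v $ 3 = 0 \<and> v $ 2 / v $ 1 \<in> S}
    = (\<lambda>(m, z). z *s vector [1, m, 0]) ` (D \<times> (UNIV - {0}))" (is "?L = ?F ` ?R")
  proof (intro equalityI subsetI)
    fix v assume v: "v \<in> ?L"
    then have "v = ?F (v $ 2 / v $ 1, v $ 1)" "v $ 1 \<noteq> 0" "v $ 2 / v $ 1 \<in> D"
      using B_cone_infinity_iff[of v f] assms by (auto simp: vector_3_eq_iff D_def)
    then show "v \<in> ?F ` ?R" by blast
  qed (auto simp: B_cone_infinity_iff assms D_def)
  moreover have "inj_on ?F ?R" by (auto intro!: inj_onI simp: vector_3_eq_iff)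
  ultimately show ?thesis by (simp add: card_image card_cartesian_product D_def)
qed

text \<open>Coefficients can be pulled inside \<open>\<sigma>\<close> since it is onto. The preimage
  of \<open>z = 0\<close> becomes the zero set of an ordinary linear form.\<close>

lemma semilinear_bij_third_coordinate:
  fixes \<psi> :: "'a::field ^ 3 \<Rightarrow> 'a ^ 3"
  assumes \<sigma>: "field_automorphism \<sigma>" and \<psi>: "semilinear_bij \<sigma> \<psi>"
  shows "\<exists>a b c. \<forall>v. \<psi> v $ 3 = \<sigma> (a * v $ 1 + b * v $ 2 + c * v $ 3)"
proof -
  have surj: "surj \<sigma>" and \<sigma>_hom: "\<And>x y. \<sigma> (x + y) = \<sigma> x + \<sigma> y" "\<And>x y. \<sigma> (x * y) = \<sigma> x * \<sigma> y"
    using \<sigma> by (auto simp: field_automorphism_def bij_def)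
  have add: "\<psi> (v + w) = \<psi> v + \<psi> w" and scale: "\<psi> (k *s v) = \<sigma> k *s \<psi> v" for v w k
    using \<psi> by (auto simp: semilinear_bij_def)
  obtain a where a: "\<psi> (vector [1, 0, 0]) $ 3 = \<sigma> a" using surj by (meson surjD)
  obtain b where b: "\<psi> (vector [0, 1, 0]) $ 3 = \<sigma> b" using surj by (meson surjD)
  obtain c where c: "\<psi> (vector [0, 0, 1]) $ 3 = \<sigma> c" using surj by (meson surjD)
  have "\<psi> v $ 3 = \<sigma> (a * v $ 1 + b * v $ 2 + c * v $ 3)" for v
  proof -
    have v: "v = v $ 1 *s vector [1, 0, 0] + v $ 2 *s vector [0, 1, 0] + v $ 3 *s vector [0, 0, 1]"
      by (simp add: vector_3_eq_iff)
    show ?thesis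
      by (subst v) (simp only: add scale vector_add_component vector_smult_component a b c \<sigma>_hom
          mult.commute)
  qed
  then show ?thesis by blast
qed

text \<open>
  Both \<open>z = 0\<close> and its preimage miss the same number of vectors of the cone, so as many vectors lie
  on the preimage only as on \<open>z = 0\<close> only.
\<close>

lemma B_cone_nonaffine_image:
  fixes f g :: "'a::{field,finite} poly"
  assumes q: "primepow q" and n: "n \<ge> 2" and card: "CARD('a) = q ^ n"
    and f: "f \<in> q_polynomials n q" and max: "max_field_of_linearity_is_base n q f"
    and \<sigma>: "field_automorphism \<sigma>" and \<psi>: "semilinear_bij \<sigma> \<psi>"
    and cone: "\<And>v. v \<in> B_cone f \<longleftrightarrow> \<psi> v \<in> B_cone g"
    and v0: "v0 $ 3 = 0" "\<psi> v0 $ 3 \<noteq> 0"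
  shows "\<exists>p y d. y \<noteq> 0 \<and> d \<noteq> 0 \<and> (\<forall>x. poly f x = p * x + y * (\<Sum>i<n. (d * x) ^ (q ^ i)))"
proof -
  obtain a b c where abc: "\<And>v. \<psi> v $ 3 = \<sigma> (a * v $ 1 + b * v $ 2 + c * v $ 3)"
    using semilinear_bij_third_coordinate[OF \<sigma> \<psi>] by blast
  have plane: "\<psi> v $ 3 = 0 \<longleftrightarrow> a * v $ 1 + b * v $ 2 + c * v $ 3 = 0" for v
    by (simp add: abc field_automorphism_0_1[OF \<sigma>])
  \<comment> \<open>\<open>v0\<close> lies at infinity but off the preimage, so the form is not a
    multiple of the third coordinate.\<close>
  have ab: "(a, b) \<noteq> (0, 0)" using v0 plane[of v0] by auto
  have f0: "poly f 0 = 0" using q f by (rule q_polynomial_0)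
  have inj: "inj \<psi>" and surj: "surj \<psi>" using \<psi> by (auto simp: semilinear_bij_def bij_def)
  have affine: "card {v \<in> B_cone k. v $ 3 \<noteq> 0} = CARD('a) * (CARD('a) - 1)" for k :: "'a poly"
    using card_B_cone_affine_part[of k UNIV] by simp
  \<comment> \<open>The affine part of a cone has a size depending on the field only, so it is the
    same for \<open>f\<close> and \<open>g\<close>.\<close>
  have "\<psi> ` {v \<in> B_cone f. \<psi> v $ 3 \<noteq> 0} = {v \<in> B_cone g. v $ 3 \<noteq> 0}"
    using cone surj by (auto simp: image_iff surj_def)
  moreover have "inj_on \<psi> {v \<in> B_cone f. \<psi> v $ 3 \<noteq> 0}" using inj subset_UNIV by (rule inj_on_subset)
  ultimately have "card {v \<in> B_cone f. \<psi> v $ 3 \<noteq> 0} = card {v \<in> B_cone f. v $ 3 \<noteq> 0}"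
    using card_image by (fastforce simp: affine)
  then have "card ({v \<in> B_cone f. v $ 3 \<noteq> 0} - {v \<in> B_cone f. \<psi> v $ 3 \<noteq> 0})
      = card ({v \<in> B_cone f. \<psi> v $ 3 \<noteq> 0} - {v \<in> B_cone f. v $ 3 \<noteq> 0})"
    by (simp add: card_Diff_subset_Int Int_commute)
  moreover have "{v \<in> B_cone f. v $ 3 \<noteq> 0} - {v \<in> B_cone f. \<psi> v $ 3 \<noteq> 0}
      = {v \<in> B_cone f. v $ 3 \<noteq> 0 \<and> \<psi> v $ 3 = 0}"
    and "{v \<in> B_cone f. \<psi> v $ 3 \<noteq> 0} - {v \<in> B_cone f. v $ 3 \<noteq> 0}
      = {v \<in> B_cone f. v $ 3 = 0 \<and> \<psi> v $ 3 \<noteq> 0}"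
    by blast+
  ultimately have swap: "card {v \<in> B_cone f. v $ 3 \<noteq> 0 \<and> \<psi> v $ 3 = 0}
      = card {v \<in> B_cone f. v $ 3 = 0 \<and> \<psi> v $ 3 \<noteq> 0}"
    by simp
  have "{v \<in> B_cone f. v $ 3 \<noteq> 0 \<and> \<psi> v $ 3 = 0}
      = {v \<in> B_cone f. v $ 3 \<noteq> 0 \<and> v $ 1 / v $ 3 \<in> {x. a * x + b * poly f x + c = 0}}"
  proof (intro Collect_cong conj_cong refl)
    fix v assume "v \<in> B_cone f" "v $ 3 \<noteq> 0"
    then have "poly f (v $ 1 / v $ 3) = v $ 2 / v $ 3" by (simp add: B_cone_affine_iff)
    with \<open>v $ 3 \<noteq> 0\<close> show "\<psi> v $ 3 = 0 \<longleftrightarrow> v $ 1 / v $ 3 \<in> {x. a * x + b * poly f x + c = 0}"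
      by (simp add: plane field_simps)
  qed
  then have 1: "card {v \<in> B_cone f. v $ 3 \<noteq> 0 \<and> \<psi> v $ 3 = 0}
      = card {x. a * x + b * poly f x + c = 0} * (CARD('a) - 1)"
    by (simp only: card_B_cone_affine_part)
  have "{v \<in> B_cone f. v $ 3 = 0 \<and> \<psi> v $ 3 \<noteq> 0}
      = {v \<in> B_cone f. v $ 3 = 0 \<and> v $ 2 / v $ 1 \<in> {m. a + b * m \<noteq> 0}}"
  proof (intro Collect_cong conj_cong refl)
    fix v assume "v \<in> B_cone f" "v $ 3 = 0"
    then have "v $ 1 \<noteq> 0" using B_cone_infinity_iff f0 by blast
    with \<open>v $ 3 = 0\<close> show "\<psi> v $ 3 \<noteq> 0 \<longleftrightarrow> v $ 2 / v $ 1 \<in> {m. a + b * m \<noteq> 0}"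
      by (simp add: plane field_simps)
  qed
  then have 2: "card {v \<in> B_cone f. v $ 3 = 0 \<and> \<psi> v $ 3 \<noteq> 0}
      = card {m \<in> {m. a + b * m \<noteq> 0}. \<exists>x. x \<noteq> 0 \<and> poly f x = m * x} * (CARD('a) - 1)"
    by (simp only: card_B_cone_infinity_part[of f, OF f0])
  \<comment> \<open>This makes the common factor \<open>CARD('a) - 1\<close> positive, so it cancels
    from \<open>swap\<close>.\<close>
  have "CARD('a) > 1" using card one_less_power[of q n] primepow_gt_Suc_0[OF q] n by simp
  then have "card {x. a * x + b * poly f x + c = 0}
      = card {m. (\<exists>x. x \<noteq> 0 \<and> poly f x = m * x) \<and> a + b * m \<noteq> 0}"
    using swap unfolding 1 2 by (simp add: conj_commute)
  then show ?thesis by (rule q_polynomial_second_long_secant[OF q n card f max ab])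
qed

subsection \<open>Equivalence of the polynomials and of the point sets\<close>

text \<open>Any two graphs of this shape with the same function \<open>T\<close> are related by a
  linear map that strips off \<open>p * x\<close>, rescales \<open>y\<close> to \<open>y'\<close>
  and adds the new linear term.\<close>

lemma U_set_linear_image:
  fixes f g :: "'a::{field,finite} poly"
  assumes "y \<noteq> 0" "d \<noteq> 0" and f: "\<And>x. poly f x = p * x + y * T (d * x)"
    and "y' \<noteq> 0" "d' \<noteq> 0" and g: "\<And>x. poly g x = p' * x + y' * T (d' * x)"
  shows "\<exists>\<phi>. semilinear_bij id \<phi> \<and> \<phi> ` U_set f = U_set g"
proof -
  \<comment> \<open>Scaling the first coordinate by \<open>k\<close> keeps the argument of
    \<open>T\<close>, since \<open>d' * k = d\<close>.\<close>
  define k where "k = d / d'"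
  define \<phi> where "\<phi> u = (vector [k * u $ 1, p' * k * u $ 1 + y' / y * (u $ 2 - p * u $ 1)] :: 'a ^ 2)"
    for u :: "'a ^ 2"
  have k: "k \<noteq> 0" "d' * (k * x) = d * x" for x using assms by (simp_all add: k_def)
  have inj: "inj \<phi>"
    using k(1) assms by (auto intro!: injI simp: \<phi>_def vector_2_eq_iff)
  have "\<phi> (vector [x, poly f x]) \<in> U_set g" for x
    using assms(1) by (simp add: U_set_iff \<phi>_def f g k)
  then have "\<phi> ` U_set f = U_set g" by (rule U_set_image_eqI[OF inj])
  moreover have "semilinear_bij id \<phi>"
    by (rule semilinear_bijI[OF inj])
      (simp_all add: \<phi>_def vector_2_eq_iff algebra_simps add_divide_distrib diff_divide_distrib)
  ultimately show ?thesis by blast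
qed

text \<open>The set \<open>{id, \<sigma>}\<close> records two cases: a map preserving
  \<open>z = 0\<close> induces one with companion \<open>\<sigma>\<close>, and otherwise both
  polynomials have trace form and are linearly equivalent.\<close>

lemma B_cone_image_imp_U_set_image:
  fixes f g :: "'a::{field,finite} poly"
  assumes q: "primepow q" and n: "n \<ge> 2" and card: "CARD('a) = q ^ n"
    and f: "f \<in> q_polynomials n q" and g: "g \<in> q_polynomials n q"
    and maxf: "max_field_of_linearity_is_base n q f" and maxg: "max_field_of_linearity_is_base n q g"
    and \<sigma>: "field_automorphism \<sigma>" and \<psi>: "semilinear_bij \<sigma> \<psi>"
    and cone: "\<And>v. v \<in> B_cone f \<longleftrightarrow> \<psi> v \<in> B_cone g"
  shows "\<exists>\<tau> \<phi>. \<tau> \<in> {id, \<sigma>} \<and> semilinear_bij \<tau> \<phi> \<and> \<phi> ` U_set f = U_set g"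
proof (cases "\<forall>v. v $ 3 = 0 \<longrightarrow> \<psi> v $ 3 = 0")
  case True
  have "poly f 0 = 0" using q f by (rule q_polynomial_0)
  then show ?thesis
    using B_cone_affine_image[OF \<sigma> \<psi> _ q_polynomial_add[OF q card g]] cone True by blast
next
  case False
  then obtain v0 where v0: "v0 $ 3 = 0" "\<psi> v0 $ 3 \<noteq> 0" by blast
  have bij: "bij \<psi>" using \<psi> by (simp add: semilinear_bij_def)
  \<comment> \<open>If \<open>inv \<psi>\<close> mapped the finite plane \<open>z = 0\<close> into
    itself it would map it onto itself, making \<open>v0\<close> a preimage of a vector in that
    plane. So the counting argument also applies to \<open>g\<close> and
    \<open>inv \<psi>\<close>.\<close>
  obtain w0 where w0: "w0 $ 3 = 0" "inv \<psi> w0 $ 3 \<noteq> 0"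
  proof (rule ccontr)
    assume "\<not> thesis"
    then have "inv \<psi> ` {v. v $ 3 = 0} \<subseteq> {v. v $ 3 = 0}" using that by blast
    then have "inv \<psi> ` {v. v $ 3 = 0} = {v. v $ 3 = 0}"
      using inj_on_subset[OF bij_is_inj[OF bij_imp_bij_inv[OF bij]] subset_UNIV]
      by (intro endo_inj_surj) auto
    then obtain w where "w $ 3 = 0" "v0 = inv \<psi> w" using v0 by blast
    then show False using v0 bij by (simp add: bij_is_surj surj_f_inv_f)
  qed
  obtain p y d where "y \<noteq> 0" "d \<noteq> 0" "\<And>x. poly f x = p * x + y * (\<Sum>i<n. (d * x) ^ (q ^ i))"
    using B_cone_nonaffine_image[OF q n card f maxf \<sigma> \<psi> cone v0] by blast
  moreover have "v \<in> B_cone g \<longleftrightarrow> inv \<psi> v \<in> B_cone f" for v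
    using cone bij by (simp add: bij_is_surj surj_f_inv_f)
  then obtain p' y' d' where
    "y' \<noteq> 0" "d' \<noteq> 0" "\<And>x. poly g x = p' * x + y' * (\<Sum>i<n. (d' * x) ^ (q ^ i))"
    using B_cone_nonaffine_image[OF q n card g maxg field_automorphism_inv[OF \<sigma>]
        semilinear_bij_inv[OF \<sigma> \<psi>] _ w0] by blast
  ultimately show ?thesis
    using U_set_linear_image[of y d f p "\<lambda>x. \<Sum>i<n. x ^ (q ^ i)" y' d' g p'] by blast
qed

lemma U_set_image_imp_B_cone_image:
  fixes f g :: "'a::{field,finite} poly"
  assumes \<sigma>: "field_automorphism \<sigma>" and \<phi>: "semilinear_bij \<sigma> \<phi>" and U: "\<phi> ` U_set f = U_set g"
    and f0: "poly f 0 = 0"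
  shows "\<exists>\<psi>. semilinear_bij \<sigma> \<psi> \<and> (\<forall>v. v \<in> B_cone f \<longleftrightarrow> \<psi> v \<in> B_cone g)"
proof -
  define D where "D v = (vector [v $ 1, v $ 2] :: 'a ^ 2)" for v :: "'a ^ 3"
  \<comment> \<open>Applying \<open>\<sigma>\<close> to the third coordinate gives the extension the
    same companion as \<open>\<phi>\<close> and makes it compatible with the chart
    \<open>z = 1\<close>.\<close>
  define \<psi> where "\<psi> v = (vector [\<phi> (D v) $ 1, \<phi> (D v) $ 2, \<sigma> (v $ 3)] :: 'a ^ 3)" for v
  have add: "\<phi> (v + w) = \<phi> v + \<phi> w" and scale: "\<phi> (k *s v) = \<sigma> k *s \<phi> v" for v w k
    using \<phi> by (auto simp: semilinear_bij_def)
  have inj: "inj \<phi>" using \<phi> by (auto simp: semilinear_bij_def bij_def)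
  have \<sigma>_inj: "inj \<sigma>" and \<sigma>_add: "\<sigma> (x + y) = \<sigma> x + \<sigma> y" and \<sigma>_mult: "\<sigma> (x * y) = \<sigma> x * \<sigma> y" for x y
    using \<sigma> by (auto simp: field_automorphism_def bij_def)
  have D: "D (v + w) = D v + D w" "D (k *s v) = k *s D v" for v w k
    by (simp_all add: D_def vector_2_eq_iff)
  have \<psi>_inj: "inj \<psi>"
  proof (rule injI)
    fix v w assume "\<psi> v = \<psi> w"
    then have "\<phi> (D v) = \<phi> (D w)" "\<sigma> (v $ 3) = \<sigma> (w $ 3)"
      by (simp_all add: \<psi>_def vector_2_eq_iff vector_3_eq_iff)
    then have "D v = D w" "v $ 3 = w $ 3" using inj \<sigma>_inj by (simp_all add: inj_eq)
    then show "v = w" by (simp add: D_def vector_2_eq_iff vector_3_eq_iff)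
  qed
  have semi: "semilinear_bij \<sigma> \<psi>"
    by (rule semilinear_bijI[OF \<psi>_inj])
      (simp_all add: \<psi>_def vector_3_eq_iff D add scale \<sigma>_add \<sigma>_mult)
  have maps: "u \<in> U_set f \<longleftrightarrow> \<phi> u \<in> U_set g" for u
    using U inj by (metis inj_image_mem_iff)
  have "v \<in> B_cone f \<longleftrightarrow> \<psi> v \<in> B_cone g" for v
  proof (cases "v $ 3 = 0")
    case False
    let ?r = "inverse (v $ 3)"
    have r: "\<sigma> ?r = inverse (\<sigma> (v $ 3))"
      using \<sigma>_mult[of ?r "v $ 3"] False field_automorphism_0_1[OF \<sigma>]
      by (simp add: field_simps)
    have "v \<in> B_cone f \<longleftrightarrow> ?r *s D v \<in> U_set f"
      by (simp add: B_cone_affine_iff[OF False] U_set_iff D_def divide_inverse_commute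
          eq_commute[of "poly f _"])
    also have "\<dots> \<longleftrightarrow> inverse (\<sigma> (v $ 3)) *s \<phi> (D v) \<in> U_set g"
      unfolding maps scale r ..
    also have "\<dots> \<longleftrightarrow> \<psi> v \<in> B_cone g"
    proof -
      have "\<psi> v $ 3 \<noteq> 0" using False field_automorphism_0_1(3)[OF \<sigma>] by (simp add: \<psi>_def)
      then show ?thesis
        by (auto simp: B_cone_affine_iff U_set_iff \<psi>_def divide_inverse_commute)
    qed
    finally show ?thesis .
  next
    case True
    \<comment> \<open>At infinity, membership means that the line spanned by \<open>D w\<close>
      meets the graph outside the origin, a condition that \<open>\<phi>\<close> transports.\<close>
    have mem: "w \<in> B_cone k \<longleftrightarrow> (\<exists>l. l *s D w \<in> U_set k \<and> l *s D w \<noteq> 0)"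
      if w: "w $ 3 = 0" "poly k 0 = 0" for w k
    proof
      assume "w \<in> B_cone k"
      then obtain x where x: "w $ 1 \<noteq> 0" "x \<noteq> 0" "poly k x = w $ 2 / w $ 1 * x"
        using B_cone_infinity_iff[OF w] by blast
      then show "\<exists>l. l *s D w \<in> U_set k \<and> l *s D w \<noteq> 0"
        by (intro exI[of _ "x / w $ 1"]) (simp add: U_set_iff D_def vector_2_eq_iff)
    next
      assume "\<exists>l. l *s D w \<in> U_set k \<and> l *s D w \<noteq> 0"
      then obtain l where "l *s D w \<in> U_set k" "l *s D w \<noteq> 0" by blast
      then have l: "poly k (l * w $ 1) = l * w $ 2" "l *s D w \<noteq> 0"
        by (simp_all add: U_set_iff D_def)
      then have "l * w $ 1 \<noteq> 0" using w by (auto simp: vector_2_eq_iff D_def)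
      with l show "w \<in> B_cone k"
        by (auto simp: B_cone_infinity_iff[OF w] intro!: exI[of _ "l * w $ 1"])
    qed
    have "vector [0, 0] \<in> U_set f" by (simp add: U_set_iff f0)
    moreover have "vector [0, 0] = (0 :: 'a ^ 2)" by (simp add: vector_2_eq_iff)
    ultimately have g0: "poly g 0 = 0"
      using maps[of 0] semilinear_bij_0[OF \<phi>] by (simp add: U_set_iff)
    have D\<psi>: "D (\<psi> v) = \<phi> (D v)" by (simp add: D_def \<psi>_def vector_2_eq_iff)
    have "\<phi> u = 0 \<longleftrightarrow> u = 0" for u using semilinear_bij_0[OF \<phi>] inj by (metis injD)
    then have "(\<exists>l. l *s D v \<in> U_set f \<and> l *s D v \<noteq> 0)
        \<longleftrightarrow> (\<exists>l. \<sigma> l *s \<phi> (D v) \<in> U_set g \<and> \<sigma> l *s \<phi> (D v) \<noteq> 0)"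
      by (metis maps scale)
    \<comment> \<open>\<open>\<sigma>\<close> is onto, so \<open>\<sigma> l\<close> runs over all
      scalars.\<close>
    also have "\<dots> \<longleftrightarrow> (\<exists>l. l *s \<phi> (D v) \<in> U_set g \<and> l *s \<phi> (D v) \<noteq> 0)"
      using \<sigma> by (metis bij_pointE field_automorphism_def)
    also have "\<dots> \<longleftrightarrow> \<psi> v \<in> B_cone g"
    proof -
      have "\<psi> v $ 3 = 0" using True field_automorphism_0_1(1)[OF \<sigma>] by (simp add: \<psi>_def)
      then show ?thesis by (simp only: mem[OF _ g0] D\<psi>)
    qed
    finally show ?thesis by (simp only: mem[OF True f0])
  qed
  with semi show ?thesis by blast
qed

theorem theorem6p1:
  fixes q n :: nat and f g :: "'a::{field,finite} poly"
  assumes "primepow q" and "n \<ge> 2" and "CARD('a) = q ^ n"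
    and "f \<in> q_polynomials n q" and "g \<in> q_polynomials n q"
    and "max_field_of_linearity_is_base n q f" and "max_field_of_linearity_is_base n q g"
  shows "(equivalent_under PGammaL (B_set q f) (B_set q g) \<longleftrightarrow> q_poly_equivalent f g) \<and>
         (equivalent_under PGL (B_set q f) (B_set q g) \<longleftrightarrow> q_poly_linearly_equivalent f g)"
proof -
  have q0: "q > 0" using assms(1) by (rule primepow_gt_0_nat)
  have f0: "poly f 0 = 0" using assms(1,4) by (rule q_polynomial_0)
  have B_eq: "B_set q h = (\<lambda>v. vec.span {v}) ` B_cone h" if "h \<in> q_polynomials n q" for h :: "'a poly"
    by (rule B_set_eq[OF q_polynomial_scale[OF that] q0])
  note B_iff = B_set_image_iff[OF _ _ B_eq[OF assms(4)] B_eq[OF assms(5)]]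
  have fwd: "\<exists>\<tau> \<phi>. \<tau> \<in> {id, \<sigma>} \<and> semilinear_bij \<tau> \<phi> \<and> \<phi> ` U_set f = U_set g"
    if "field_automorphism \<sigma>" "semilinear_bij \<sigma> \<psi>"
      "restrict (image \<psi>) proj_points ` B_set q f = B_set q g" for \<sigma> \<psi>
  proof -
    have "v \<in> B_cone f \<longleftrightarrow> \<psi> v \<in> B_cone g" for v
      using that(3) unfolding B_iff[OF that(1,2)] by (rule spec)
    then show ?thesis by (rule B_cone_image_imp_U_set_image[OF assms that(1,2)])
  qed
  have bwd: "\<exists>\<psi>. semilinear_bij \<sigma> \<psi> \<and> restrict (image \<psi>) proj_points ` B_set q f = B_set q g"
    if "field_automorphism \<sigma>" "semilinear_bij \<sigma> \<phi>" "\<phi> ` U_set f = U_set g" for \<sigma> \<phi>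
  proof -
    from U_set_image_imp_B_cone_image[OF that f0]
    obtain \<psi> where "semilinear_bij \<sigma> \<psi>" "\<forall>v. v \<in> B_cone f \<longleftrightarrow> \<psi> v \<in> B_cone g"
      by blast
    with B_iff[OF that(1)] show ?thesis by blast
  qed
  have "equivalent_under PGammaL (B_set q f) (B_set q g) \<longleftrightarrow> q_poly_equivalent f g"
    unfolding q_poly_equivalent_def equivalent_under_PGammaL_iff equivalent_under_GammaL_iff
  proof
    assume "\<exists>\<sigma> \<psi>. field_automorphism \<sigma> \<and> semilinear_bij \<sigma> \<psi>
      \<and> restrict (image \<psi>) proj_points ` B_set q f = B_set q g"
    then obtain \<sigma> \<psi> where \<sigma>: "field_automorphism \<sigma>" and "semilinear_bij \<sigma> \<psi>"
      "restrict (image \<psi>) proj_points ` B_set q f = B_set q g" by (elim exE conjE)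
    from fwd[OF this] obtain \<tau> \<phi>
      where "\<tau> \<in> {id, \<sigma>}" and \<phi>: "semilinear_bij \<tau> \<phi>" "\<phi> ` U_set f = U_set g" by (elim exE conjE)
    then have "field_automorphism \<tau>" using \<sigma> field_automorphism_id by auto
    show "\<exists>\<sigma> \<phi>. field_automorphism \<sigma> \<and> semilinear_bij \<sigma> \<phi> \<and> \<phi> ` U_set f = U_set g"
      by (rule exI[of _ \<tau>], rule exI[of _ \<phi>]) (intro conjI \<phi> \<open>field_automorphism \<tau>\<close>)
  next
    assume "\<exists>\<sigma> \<phi>. field_automorphism \<sigma> \<and> semilinear_bij \<sigma> \<phi> \<and> \<phi> ` U_set f = U_set g"
    then obtain \<sigma> \<phi> where \<sigma>: "field_automorphism \<sigma>" and "semilinear_bij \<sigma> \<phi>" "\<phi> ` U_set f = U_set g"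
      by (elim exE conjE)
    from bwd[OF this] obtain \<psi> where \<psi>: "semilinear_bij \<sigma> \<psi>"
      "restrict (image \<psi>) proj_points ` B_set q f = B_set q g" by (elim exE conjE)
    show "\<exists>\<sigma> \<psi>. field_automorphism \<sigma> \<and> semilinear_bij \<sigma> \<psi>
      \<and> restrict (image \<psi>) proj_points ` B_set q f = B_set q g"
      by (rule exI[of _ \<sigma>], rule exI[of _ \<psi>]) (intro conjI \<sigma> \<psi>)
  qed
  moreover have "equivalent_under PGL (B_set q f) (B_set q g) \<longleftrightarrow> q_poly_linearly_equivalent f g"
    unfolding q_poly_linearly_equivalent_def equivalent_under_PGL_iff equivalent_under_GL_iff
  proof (intro iffI; elim exE conjE)
    fix \<psi> :: "'a ^ 3 \<Rightarrow> 'a ^ 3"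
    assume "semilinear_bij id \<psi>" "restrict (image \<psi>) proj_points ` B_set q f = B_set q g"
    \<comment> \<open>With \<open>\<sigma> = id\<close> the set \<open>{id, \<sigma>}\<close>
      collapses, so both cases yield a linear map.\<close>
    from fwd[OF field_automorphism_id this]
    show "\<exists>\<phi>. semilinear_bij id \<phi> \<and> \<phi> ` U_set f = U_set g" by simp
  qed (rule bwd[OF field_automorphism_id])
  ultimately show ?thesis ..
qed

end
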